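(* Let $T$ be a complete theory eliminating imaginaries, and let $M\models T$ be atomic and strongly $\omega$-homogeneous over a set of parameters $A\subseteq M$. Let $B$ be a normal extension of $A$ in $M$ with $B=\operatorname{dcl}(B)$, such that every elementary permutation of $B$ fixing $A$ pointwise extends to an automorphism of $M$ and such that $M$ is atomic and strongly $\omega$-homogeneous over $B$. Let $G$ be an $A$-definable group and let $\varphi$ be a function from $\operatorname{Aut}(B/A)$ to $G(B)$. Then there exist an $A$-definable function $h(\bar x,\bar y)$ and a finite tuple $\bar b$ from $B$ such that $\varphi(\sigma)=h(\bar b,\sigma(\bar b))$ for all $\sigma\in \operatorname{Aut}(B/A)$ if and only if the graph of $\varphi$ is a definable subset of $\operatorname{Aut}(B/A)\times G(M)$.
   Context: $M$ is atomic over $A$ if the type over $A$ of every finite tuple from $M$ is isolated. $M$ is strongly $\omega$-homogeneous over $A$ if for any two finite tuples from $M$ with the same type over $A$ there is an automorphism of $M$ fixing $A$ pointwise and taking one to the other. A set $B$ with $A\subseteq B\subseteq M$ is a normal extension of $A$ in $M$ if for every finite tuple $\bar b$ from $B$, every realization of $\operatorname{tp}(\bar b/A)$ in $M$ is contained in $B$. $\operatorname{Aut}(B/A)$ is the group of permutations of $B$ that are elementary (in the sense of $M$) and fix $A$ pointwise. $G(B)$ is the set of elements of $G(M)$ all of whose coordinates lie in $B$. For an $A$-definable set $X$, a subset $\Lambda\subseteq \operatorname{Aut}(B/A)\times X(M)$ is called definable if there are an $A$-formula $\psi(\bar x,\bar y,\bar z)$ and a finite tuple $\bar b$ from $B$ such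 that $$\Lambda=\{(\sigma,\bar c)\in \operatorname{Aut}(B/A)\times X(M): M\models \psi(\bar b,\sigma(\bar b),\bar c)\}.$$ *)

theory Defs
  imports "HOL-Algebra.Group" "HOL-Combinatorics.Permutations"
begin

section \<open>First-order languages, structures and satisfaction\<close>

text \<open>
  A language assigns to each of its symbols an arity; the names that are mapped to \<open>None\<close> are not
  symbols of the language.  Thus languages without function or without relation symbols are
  included.
\<close>

record ('f, 'r) lang =
  fun_arity :: "'f \<Rightarrow> nat option"
  rel_arity :: "'r \<Rightarrow> nat option"

datatype 'f trm = Var nat | Fn 'f "'f trm list"

datatype ('f, 'r) fm =
    Eql "'f trm" "'f trm"
  | Rel 'r "'f trm list"
  | Neg "('f, 'r) fm"
  | Conj "('f, 'r) fm" "('f, 'r) fm"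
  | Exi nat "('f, 'r) fm"

fun wf_trm :: "('f, 'r) lang \<Rightarrow> 'f trm \<Rightarrow> bool" where
  "wf_trm L (Var i) \<longleftrightarrow> True"
| "wf_trm L (Fn f ts) \<longleftrightarrow> fun_arity L f = Some (length ts) \<and> (\<forall>t\<in>set ts. wf_trm L t)"

fun wf_fm :: "('f, 'r) lang \<Rightarrow> ('f, 'r) fm \<Rightarrow> bool" where
  "wf_fm L (Eql s t) \<longleftrightarrow> wf_trm L s \<and> wf_trm L t"
| "wf_fm L (Rel r ts) \<longleftrightarrow> rel_arity L r = Some (length ts) \<and> (\<forall>t\<in>set ts. wf_trm L t)"
| "wf_fm L (Neg p) \<longleftrightarrow> wf_fm L p"
| "wf_fm L (Conj p q) \<longleftrightarrow> wf_fm L p \<and> wf_fm L q"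
| "wf_fm L (Exi i p) \<longleftrightarrow> wf_fm L p"

fun fv_trm :: "'f trm \<Rightarrow> nat set" where
  "fv_trm (Var i) = {i}"
| "fv_trm (Fn f ts) = (\<Union>t\<in>set ts. fv_trm t)"

fun fv_fm :: "('f, 'r) fm \<Rightarrow> nat set" where
  "fv_fm (Eql s t) = fv_trm s \<union> fv_trm t"
| "fv_fm (Rel r ts) = (\<Union>t\<in>set ts. fv_trm t)"
| "fv_fm (Neg p) = fv_fm p"
| "fv_fm (Conj p q) = fv_fm p \<union> fv_fm q"
| "fv_fm (Exi i p) = fv_fm p - {i}"

text \<open>The formulas of \<open>L\<close> in the variables \<open>0, \<dots>, n - 1\<close>; for \<open>n = 0\<close> these are the sentences.\<close>

definition Fm :: "('f, 'r) lang \<Rightarrow> nat \<Rightarrow> ('f, 'r) fm set" where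
  "Fm L n = {p. wf_fm L p \<and> fv_fm p \<subseteq> {..<n}}"

record ('m, 'f, 'r) struct =
  univ :: "'m set"
  fun_int :: "'f \<Rightarrow> 'm list \<Rightarrow> 'm"
  rel_int :: "'r \<Rightarrow> 'm list \<Rightarrow> bool"

definition tuples :: "'m set \<Rightarrow> nat \<Rightarrow> 'm list set" where
  "tuples S n = {xs. length xs = n \<and> set xs \<subseteq> S}"

definition is_struct :: "('f, 'r) lang \<Rightarrow> ('m, 'f, 'r) struct \<Rightarrow> bool" where
  "is_struct L M \<longleftrightarrow> univ M \<noteq> {} \<and>
     (\<forall>f n. fun_arity L f = Some n \<longrightarrow> (\<forall>xs\<in>tuples (univ M) n. fun_int M f xs \<in> univ M))"

fun eval_trm :: "('m, 'f, 'r) struct \<Rightarrow> (nat \<Rightarrow> 'm) \<Rightarrow> 'f trm \<Rightarrow> 'm" where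
  "eval_trm M e (Var i) = e i"
| "eval_trm M e (Fn f ts) = fun_int M f (map (eval_trm M e) ts)"

fun eval_fm :: "('m, 'f, 'r) struct \<Rightarrow> (nat \<Rightarrow> 'm) \<Rightarrow> ('f, 'r) fm \<Rightarrow> bool" where
  "eval_fm M e (Eql s t) \<longleftrightarrow> eval_trm M e s = eval_trm M e t"
| "eval_fm M e (Rel r ts) \<longleftrightarrow> rel_int M r (map (eval_trm M e) ts)"
| "eval_fm M e (Neg p) \<longleftrightarrow> \<not> eval_fm M e p"
| "eval_fm M e (Conj p q) \<longleftrightarrow> eval_fm M e p \<and> eval_fm M e q"
| "eval_fm M e (Exi i p) \<longleftrightarrow> (\<exists>a\<in>univ M. eval_fm M (e(i := a)) p)"

text \<open>
  \<open>sat M p xs\<close> is used for \<open>p \<in> Fm L n\<close> and \<open>xs \<in> tuples (univ M) n\<close>; the values of \<open>nth xs\<close> beyond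
  the length of \<open>xs\<close> are then irrelevant.
\<close>

definition sat :: "('m, 'f, 'r) struct \<Rightarrow> ('f, 'r) fm \<Rightarrow> 'm list \<Rightarrow> bool" where
  "sat M p xs \<longleftrightarrow> eval_fm M (nth xs) p"

section \<open>Theories\<close>

definition models :: "('f, 'r) lang \<Rightarrow> ('m, 'f, 'r) struct \<Rightarrow> ('f, 'r) fm set \<Rightarrow> bool" where
  "models L M T \<longleftrightarrow> is_struct L M \<and> (\<forall>p\<in>T. sat M p [])"

text \<open>
  HOL cannot quantify over the models of \<open>T\<close> in all types.  In the definitions of \<open>entails\<close>,
  \<open>complete_theory\<close> and \<open>eliminates_imaginaries\<close> the models range over the structures whose universe
  is a subset of the type of formulas.  This is no restriction: that type is infinite and at least
  as large as the language, so by the downward Loewenheim--Skolem theorem every structure has an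
  elementary substructure that contains any given finite tuple and is isomorphic to one of these,
  and each of the three notions holds for all models as soon as it holds for such models.
\<close>

definition entails :: "('f, 'r) lang \<Rightarrow> ('f, 'r) fm set \<Rightarrow> ('f, 'r) fm \<Rightarrow> bool" where
  "entails L T p \<longleftrightarrow>
     (\<forall>N :: (('f, 'r) fm, 'f, 'r) struct. models L N T \<longrightarrow> sat N p [])"

definition complete_theory :: "('f, 'r) lang \<Rightarrow> ('f, 'r) fm set \<Rightarrow> bool" where
  "complete_theory L T \<longleftrightarrow> T \<subseteq> Fm L 0 \<and>
     (\<exists>N :: (('f, 'r) fm, 'f, 'r) struct. models L N T) \<and>
     (\<forall>p\<in>Fm L 0. entails L T p \<or> entails L T (Neg p))"

text \<open>
  Every class \<open>a/E\<close> of a \<open>\<emptyset>\<close>-definable equivalence relation on \<open>n\<close>-tuples of a model is interdefinable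
  with a finite real tuple \<open>c\<close>: some formula \<open>p(x, z)\<close> without parameters defines the class of \<open>a\<close> for
  \<open>z = c\<close> and for no other value of \<open>z\<close>.  The formula may depend on \<open>a\<close>.
\<close>

definition eliminates_imaginaries :: "('f, 'r) lang \<Rightarrow> ('f, 'r) fm set \<Rightarrow> bool" where
  "eliminates_imaginaries L T \<longleftrightarrow>
     (\<forall>N :: (('f, 'r) fm, 'f, 'r) struct. models L N T \<longrightarrow>
       (\<forall>n. \<forall>E\<in>Fm L (n + n).
          equiv (tuples (univ N) n)
            {(x, y). x \<in> tuples (univ N) n \<and> y \<in> tuples (univ N) n \<and> sat N E (x @ y)} \<longrightarrow>
          (\<forall>a\<in>tuples (univ N) n. \<exists>k. \<exists>p\<in>Fm L (n + k).
             \<exists>!c. c \<in> tuples (univ N) k \<and>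
               (\<forall>x\<in>tuples (univ N) n. sat N p (x @ c) \<longleftrightarrow> sat N E (x @ a)))))"

section \<open>Types, automorphisms and definability over a parameter set\<close>

text \<open>
  An \<open>A\<close>-formula in \<open>n\<close> variables is a formula in \<open>n + length as\<close> variables together with the tuple
  \<open>as\<close> from \<open>A\<close> to be substituted for the last ones.
\<close>

type_synonym ('m, 'f, 'r) pfm = "('f, 'r) fm \<times> 'm list"

definition PFm :: "('f, 'r) lang \<Rightarrow> 'm set \<Rightarrow> nat \<Rightarrow> ('m, 'f, 'r) pfm set" where
  "PFm L A n = {(p, as). set as \<subseteq> A \<and> p \<in> Fm L (n + length as)}"

definition psat :: "('m, 'f, 'r) struct \<Rightarrow> ('m, 'f, 'r) pfm \<Rightarrow> 'm list \<Rightarrow> bool" where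
  "psat M q xs \<longleftrightarrow> sat M (fst q) (xs @ snd q)"

definition tp :: "('f, 'r) lang \<Rightarrow> ('m, 'f, 'r) struct \<Rightarrow> 'm set \<Rightarrow> 'm list \<Rightarrow> ('m, 'f, 'r) pfm set" where
  "tp L M A xs = {q \<in> PFm L A (length xs). psat M q xs}"

definition isolated_type ::
  "('f, 'r) lang \<Rightarrow> ('m, 'f, 'r) struct \<Rightarrow> nat \<Rightarrow> ('m, 'f, 'r) pfm set \<Rightarrow> bool" where
  "isolated_type L M n P \<longleftrightarrow>
     (\<exists>q\<in>P. \<forall>r\<in>P. \<forall>ys\<in>tuples (univ M) n. psat M q ys \<longrightarrow> psat M r ys)"

definition atomic_over :: "('f, 'r) lang \<Rightarrow> ('m, 'f, 'r) struct \<Rightarrow> 'm set \<Rightarrow> bool" where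
  "atomic_over L M A \<longleftrightarrow> (\<forall>n. \<forall>xs\<in>tuples (univ M) n. isolated_type L M n (tp L M A xs))"

definition automorphisms ::
  "('f, 'r) lang \<Rightarrow> ('m, 'f, 'r) struct \<Rightarrow> ('m \<Rightarrow> 'm) set" where
  "automorphisms L M = {\<tau>. \<tau> permutes univ M \<and>
     (\<forall>f n. fun_arity L f = Some n \<longrightarrow>
        (\<forall>xs\<in>tuples (univ M) n. \<tau> (fun_int M f xs) = fun_int M f (map \<tau> xs))) \<and>
     (\<forall>r n. rel_arity L r = Some n \<longrightarrow>
        (\<forall>xs\<in>tuples (univ M) n. rel_int M r (map \<tau> xs) \<longleftrightarrow> rel_int M r xs))}"

definition strongly_omega_homogeneous_over ::
  "('f, 'r) lang \<Rightarrow> ('m, 'f, 'r) struct \<Rightarrow> 'm set \<Rightarrow> bool" where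
  "strongly_omega_homogeneous_over L M A \<longleftrightarrow>
     (\<forall>n. \<forall>xs\<in>tuples (univ M) n. \<forall>ys\<in>tuples (univ M) n. tp L M A xs = tp L M A ys \<longrightarrow>
        (\<exists>\<tau>\<in>automorphisms L M. (\<forall>a\<in>A. \<tau> a = a) \<and> map \<tau> xs = ys))"

definition normal_extension ::
  "('f, 'r) lang \<Rightarrow> ('m, 'f, 'r) struct \<Rightarrow> 'm set \<Rightarrow> 'm set \<Rightarrow> bool" where
  "normal_extension L M A B \<longleftrightarrow> A \<subseteq> B \<and> B \<subseteq> univ M \<and>
     (\<forall>n. \<forall>bs\<in>tuples B n. \<forall>ys\<in>tuples (univ M) n. tp L M A ys = tp L M A bs \<longrightarrow> set ys \<subseteq> B)"

definition dcl :: "('f, 'r) lang \<Rightarrow> ('m, 'f, 'r) struct \<Rightarrow> 'm set \<Rightarrow> 'm set" where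
  "dcl L M B = {a \<in> univ M. \<exists>q\<in>PFm L B 1. \<forall>x\<in>univ M. psat M q [x] \<longleftrightarrow> x = a}"

text \<open>
  \<open>Aut_over L M B A\<close> is \<open>Aut(B/A)\<close>.  The notion \<open>permutes\<close> makes a permutation of \<open>B\<close> the identity
  outside \<open>B\<close>, so that distinct elements of this set are distinct as maps on \<open>B\<close>.
\<close>

definition Aut_over ::
  "('f, 'r) lang \<Rightarrow> ('m, 'f, 'r) struct \<Rightarrow> 'm set \<Rightarrow> 'm set \<Rightarrow> ('m \<Rightarrow> 'm) set" where
  "Aut_over L M B A = {\<sigma>. \<sigma> permutes B \<and> (\<forall>a\<in>A. \<sigma> a = a) \<and>
     (\<forall>n. \<forall>p\<in>Fm L n. \<forall>bs\<in>tuples B n. sat M p (map \<sigma> bs) \<longleftrightarrow> sat M p bs)}"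

definition definable_set ::
  "('f, 'r) lang \<Rightarrow> ('m, 'f, 'r) struct \<Rightarrow> 'm set \<Rightarrow> nat \<Rightarrow> 'm list set \<Rightarrow> bool" where
  "definable_set L M A n X \<longleftrightarrow> (\<exists>q\<in>PFm L A n. X = {xs \<in> tuples (univ M) n. psat M q xs})"

definition definable_function ::
  "('f, 'r) lang \<Rightarrow> ('m, 'f, 'r) struct \<Rightarrow> 'm set \<Rightarrow> nat \<Rightarrow> 'm list set \<Rightarrow> nat \<Rightarrow>
   ('m list \<Rightarrow> 'm list) \<Rightarrow> bool" where
  "definable_function L M A m D n h \<longleftrightarrow>
     definable_set L M A m D \<and> h \<in> D \<rightarrow> tuples (univ M) n \<and>
     definable_set L M A (m + n) {x @ h x | x. x \<in> D}"

text \<open>The carrier of \<open>G\<close> is \<open>G(M)\<close>, a set of \<open>n\<close>-tuples.\<close>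

definition definable_group ::
  "('f, 'r) lang \<Rightarrow> ('m, 'f, 'r) struct \<Rightarrow> 'm set \<Rightarrow> nat \<Rightarrow> 'm list monoid \<Rightarrow> bool" where
  "definable_group L M A n G \<longleftrightarrow> group G \<and> definable_set L M A n (carrier G) \<and>
     definable_set L M A (n + n + n)
       {x @ y @ (x \<otimes>\<^bsub>G\<^esub> y) | x y. x \<in> carrier G \<and> y \<in> carrier G}"

definition group_points :: "'m list monoid \<Rightarrow> 'm set \<Rightarrow> 'm list set" where
  "group_points G B = {g \<in> carrier G. set g \<subseteq> B}"

text \<open>Definable subsets of \<open>Aut(B/A) \<times> X\<close>, where \<open>X\<close> is an \<open>A\<close>-definable set of \<open>n\<close>-tuples.\<close>

definition definable_in_Aut_times ::
  "('f, 'r) lang \<Rightarrow> ('m, 'f, 'r) struct \<Rightarrow> 'm set \<Rightarrow> 'm set \<Rightarrow> nat \<Rightarrow> 'm list set \<Rightarrow>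
   (('m \<Rightarrow> 'm) \<times> 'm list) set \<Rightarrow> bool" where
  "definable_in_Aut_times L M A B n X \<Lambda> \<longleftrightarrow>
     (\<exists>k. \<exists>q\<in>PFm L A (k + k + n). \<exists>b\<in>tuples B k.
        \<Lambda> = {(\<sigma>, c). \<sigma> \<in> Aut_over L M B A \<and> c \<in> X \<and> psat M q (b @ map \<sigma> b @ c)})"

end

theory Submission
  imports Defs
begin

text \<open>
  Definability of the graph of \<open>\<phi>\<close> means that, for some \<open>A\<close>-formula \<open>\<psi>\<close> and some tuple \<open>b\<close> of \<open>B\<close>, the
  value \<open>\<phi> \<sigma>\<close> is the only \<open>c\<close> in \<open>G(M)\<close> with \<open>\<psi>(b, \<sigma>(b), c)\<close>.  Thus \<open>\<psi>\<close> is
  single-valued at all the tuples \<open>(b, \<sigma>(b))\<close>, and restricting it to where it is yields a function: let \<open>D\<close> consist of the tuples \<open>x\<close> for which exactly one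
  \<open>c \<in> G(M)\<close> satisfies \<open>\<psi>(x, c)\<close>, and let \<open>h x\<close> be this \<open>c\<close>.  Having exactly one such \<open>c\<close> is a
  first-order condition over \<open>A\<close>, hence \<open>h\<close> is \<open>A\<close>-definable, and all the tuples \<open>(b, \<sigma>(b))\<close> lie in \<open>D\<close>.
  This is \<open>definable_function_of_unique_fibres\<close>.  Conversely, the graph of an \<open>A\<close>-definable \<open>h\<close> is given by
  an \<open>A\<close>-formula, and this formula together with \<open>b\<close> defines the graph of \<open>\<phi>\<close>.

  What has to be built is the calculus of definable sets on which "first-order condition" rests:
  closure under Boolean operations, projections and changes of coordinates.  It all reduces to
  renaming the variables of a formula (\<open>ex_rename_fm\<close>): the parameters of an
  \<open>A\<close>-formula occupy its last variables, so that they must be moved whenever the number of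
  variables changes or two lists of parameters are merged.
\<close>

section \<open>Renaming the variables of a formula\<close>

primrec rename_trm :: "(nat \<Rightarrow> nat) \<Rightarrow> 'f trm \<Rightarrow> 'f trm" where
  "rename_trm f (Var i) = Var (f i)"
| "rename_trm f (Fn g ts) = Fn g (map (rename_trm f) ts)"

lemma wf_rename_trm: "wf_trm L (rename_trm f t) \<longleftrightarrow> wf_trm L t"
  by (induction t) auto

lemma fv_rename_trm: "fv_trm (rename_trm f t) = f ` fv_trm t"
  by (induction t) auto

lemma eval_rename_trm: "eval_trm M e (rename_trm f t) = eval_trm M (\<lambda>i. e (f i)) t"
proof (induction t)
  case (Fn g ts)
  then have "map (eval_trm M e) (map (rename_trm f) ts) = map (eval_trm M (\<lambda>i. e (f i))) ts"
    by simp
  then show ?case by (simp only: rename_trm.simps eval_trm.simps)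
qed simp

lemma eval_trm_cong:
  "(\<And>i. i \<in> fv_trm t \<Longrightarrow> e i = e' i) \<Longrightarrow> eval_trm M e t = eval_trm M e' t"
proof (induction t)
  case (Fn g ts)
  then have "map (eval_trm M e) ts = map (eval_trm M e') ts"
    by (auto intro!: map_cong)
  then show ?case by (simp only: eval_trm.simps)
qed simp

lemma eval_fm_cong:
  "(\<And>i. i \<in> fv_fm p \<Longrightarrow> e i = e' i) \<Longrightarrow> eval_fm M e p \<longleftrightarrow> eval_fm M e' p"
proof (induction p arbitrary: e e')
  case (Eql s t)
  then show ?case using eval_trm_cong[of s e e' M] eval_trm_cong[of t e e' M] by simp
next
  case (Rel r ts)
  then have "map (eval_trm M e) ts = map (eval_trm M e') ts"
    by (auto intro!: map_cong eval_trm_cong)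
  then show ?case by (simp only: eval_fm.simps)
next
  case (Neg p)
  have "eval_fm M e p \<longleftrightarrow> eval_fm M e' p" by (rule Neg.IH) (use Neg.prems in auto)
  then show ?case by simp
next
  case (Conj p q)
  have "eval_fm M e p \<longleftrightarrow> eval_fm M e' p" by (rule Conj.IH(1)) (use Conj.prems in auto)
  moreover have "eval_fm M e q \<longleftrightarrow> eval_fm M e' q"
    by (rule Conj.IH(2)) (use Conj.prems in auto)
  ultimately show ?case by simp
next
  case (Exi i p)
  have "eval_fm M (e(i := a)) p \<longleftrightarrow> eval_fm M (e'(i := a)) p" for a
    by (rule Exi.IH) (use Exi.prems in auto)
  then show ?case by simp
qed

lemma finite_fv_trm: "finite (fv_trm t)"
  by (induction t) auto

lemma finite_fv_fm: "finite (fv_fm p)"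
  by (induction p) (auto simp: finite_fv_trm)

text \<open>
  The renaming \<open>f\<close> need not be injective.  To avoid the capture of a renamed free variable, each
  bound variable is replaced by one outside the image under \<open>f\<close> of the variables of its scope; the
  induction hypothesis therefore has to be available for all \<open>f\<close>.
\<close>

lemma ex_rename_fm:
  "\<exists>p'. (wf_fm L p \<longrightarrow> wf_fm L p') \<and> fv_fm p' \<subseteq> f ` fv_fm p \<and>
     (\<forall>e. eval_fm M e p' \<longleftrightarrow> eval_fm M (\<lambda>i. e (f i)) p)"
proof (induction p arbitrary: f)
  case (Eql s t)
  show ?case
    by (rule exI[of _ "Eql (rename_trm f s) (rename_trm f t)"])
      (auto simp: wf_rename_trm fv_rename_trm eval_rename_trm)
next
  case (Rel r ts)
  have eq: "map (eval_trm M e \<circ> rename_trm f) ts = map (eval_trm M (\<lambda>i. e (f i))) ts" for e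
    by (simp add: eval_rename_trm)
  show ?case
    by (rule exI[of _ "Rel r (map (rename_trm f) ts)"])
      (auto simp: wf_rename_trm fv_rename_trm eq)
next
  case (Neg p)
  then obtain p' where "(wf_fm L p \<longrightarrow> wf_fm L p') \<and> fv_fm p' \<subseteq> f ` fv_fm p \<and>
     (\<forall>e. eval_fm M e p' \<longleftrightarrow> eval_fm M (\<lambda>i. e (f i)) p)" by blast
  then show ?case by (intro exI[of _ "Neg p'"]) simp
next
  case (Conj p q)
  obtain p' where "(wf_fm L p \<longrightarrow> wf_fm L p') \<and> fv_fm p' \<subseteq> f ` fv_fm p \<and>
     (\<forall>e. eval_fm M e p' \<longleftrightarrow> eval_fm M (\<lambda>i. e (f i)) p)" using Conj.IH(1) by blast
  moreover obtain q' where "(wf_fm L q \<longrightarrow> wf_fm L q') \<and> fv_fm q' \<subseteq> f ` fv_fm q \<and>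
     (\<forall>e. eval_fm M e q' \<longleftrightarrow> eval_fm M (\<lambda>i. e (f i)) q)" using Conj.IH(2) by blast
  ultimately show ?case by (intro exI[of _ "Conj p' q'"]) auto
next
  case (Exi i p)
  obtain v where v: "v \<notin> f ` fv_fm p"
    using ex_new_if_finite[OF infinite_UNIV_nat] finite_fv_fm by blast
  obtain p' where wf: "wf_fm L p \<longrightarrow> wf_fm L p'" and fv: "fv_fm p' \<subseteq> f(i := v) ` fv_fm p"
    and ev: "\<And>e. eval_fm M e p' \<longleftrightarrow> eval_fm M (\<lambda>j. e ((f(i := v)) j)) p"
    using Exi.IH by blast
  have "eval_fm M (e(v := a)) p' \<longleftrightarrow> eval_fm M ((\<lambda>j. e (f j))(i := a)) p" for e a
    unfolding ev by (rule eval_fm_cong) (use v in auto)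
  moreover have "fv_fm p' - {v} \<subseteq> f ` (fv_fm p - {i})"
    using fv by (auto split: if_splits)
  ultimately show ?case
    using wf by (intro exI[of _ "Exi v p'"]) simp
qed

lemma sat_cong:
  assumes "p \<in> Fm L n" and "\<And>i. i < n \<Longrightarrow> xs ! i = ys ! i"
  shows "sat M p xs \<longleftrightarrow> sat M p ys"
  unfolding sat_def by (rule eval_fm_cong) (use assms in \<open>auto simp: Fm_def\<close>)

lemma rename_Fm:
  assumes p: "p \<in> Fm L n" and f: "\<And>i. i < n \<Longrightarrow> f i < m"
  obtains p' where "p' \<in> Fm L m"
    and "\<And>ys. sat M p' ys \<longleftrightarrow> sat M p (map (\<lambda>i. ys ! f i) [0..<n])"
proof -
  obtain p' where p': "wf_fm L p \<longrightarrow> wf_fm L p'" "fv_fm p' \<subseteq> f ` fv_fm p"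
    and ev: "\<And>e. eval_fm M e p' \<longleftrightarrow> eval_fm M (\<lambda>i. e (f i)) p"
    using ex_rename_fm by blast
  have "f ` fv_fm p \<subseteq> {..<m}" using p f by (auto simp: Fm_def)
  then have "p' \<in> Fm L m" using p' p by (auto simp: Fm_def)
  moreover have "sat M p' ys \<longleftrightarrow> sat M p (map (\<lambda>i. ys ! f i) [0..<n])" for ys
    unfolding sat_def ev by (rule eval_fm_cong) (use p in \<open>auto simp: Fm_def\<close>)
  ultimately show ?thesis by (rule that)
qed

section \<open>The calculus of definable sets\<close>

lemma definable_setE:
  assumes "definable_set L M A n X"
  obtains p as where "set as \<subseteq> A" "p \<in> Fm L (n + length as)"
    "X = {xs \<in> tuples (univ M) n. sat M p (xs @ as)}"
  using assms unfolding definable_set_def PFm_def psat_def by auto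

lemma definable_setI:
  assumes "set as \<subseteq> A" "p \<in> Fm L (n + length as)"
    and "\<And>xs. xs \<in> tuples (univ M) n \<Longrightarrow> sat M p (xs @ as) \<longleftrightarrow> xs \<in> X"
    and "X \<subseteq> tuples (univ M) n"
  shows "definable_set L M A n X"
  unfolding definable_set_def
  by (rule bexI[of _ "(p, as)"]) (use assms in \<open>auto simp: PFm_def psat_def\<close>)

lemma definable_set_subset: "definable_set L M A n X \<Longrightarrow> X \<subseteq> tuples (univ M) n"
  by (auto simp: definable_set_def)

lemma definable_set_compl:
  assumes "definable_set L M A n X"
  shows "definable_set L M A n (tuples (univ M) n - X)"
proof -
  obtain p as where p: "set as \<subseteq> A" "p \<in> Fm L (n + length as)"
    "X = {xs \<in> tuples (univ M) n. sat M p (xs @ as)}"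
    using assms by (rule definable_setE)
  show ?thesis
    by (rule definable_setI[of as _ "Neg p"]) (use p in \<open>auto simp: Fm_def sat_def\<close>)
qed

text \<open>
  The two formulas may use different parameters.  Those of the second formula are placed after those
  of the first one, so that the variables that stand for them are shifted.
\<close>

lemma definable_set_Int:
  assumes "definable_set L M A n X" "definable_set L M A n Y"
  shows "definable_set L M A n (X \<inter> Y)"
proof -
  obtain p as where p: "set as \<subseteq> A" "p \<in> Fm L (n + length as)"
    "X = {xs \<in> tuples (univ M) n. sat M p (xs @ as)}"
    using assms(1) by (rule definable_setE)
  obtain q bs where q: "set bs \<subseteq> A" "q \<in> Fm L (n + length bs)"
    "Y = {xs \<in> tuples (univ M) n. sat M q (xs @ bs)}"
    using assms(2) by (rule definable_setE)
  define f where "f = (\<lambda>i. if i < n then i else i + length as)"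
  obtain q' where q': "q' \<in> Fm L (n + length (as @ bs))"
    "\<And>ys. sat M q' ys \<longleftrightarrow> sat M q (map (\<lambda>i. ys ! f i) [0..<n + length bs])"
    by (rule rename_Fm[OF q(2), of f "n + length (as @ bs)"]) (auto simp: f_def)
  show ?thesis
  proof (rule definable_setI[of "as @ bs" _ "Conj p q'"])
    show "set (as @ bs) \<subseteq> A" using p q by simp
    show "Conj p q' \<in> Fm L (n + length (as @ bs))"
      using p(2) q'(1) by (auto simp: Fm_def)
    fix xs assume xs: "xs \<in> tuples (univ M) n"
    then have len: "length xs = n" by (simp add: tuples_def)
    have "sat M p (xs @ as @ bs) \<longleftrightarrow> sat M p (xs @ as)"
      by (rule sat_cong[OF p(2)]) (use len in \<open>auto simp: nth_append\<close>)
    moreover have "map (\<lambda>i. (xs @ as @ bs) ! f i) [0..<n + length bs] = xs @ bs"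
      by (rule nth_equalityI) (use len in \<open>auto simp: nth_append f_def\<close>)
    ultimately show "sat M (Conj p q') (xs @ as @ bs) \<longleftrightarrow> xs \<in> X \<inter> Y"
      using p(3) q(3) q'(2)[of "xs @ as @ bs"] xs by (simp add: sat_def)
  qed (use p in auto)
qed

lemma definable_set_Int_INT:
  fixes k :: nat
  assumes "definable_set L M A n X" "\<And>i. i < k \<Longrightarrow> definable_set L M A n (Y i)"
  shows "definable_set L M A n (X \<inter> (\<Inter>i<k. Y i))"
  using assms(2)
proof (induction k)
  case 0
  then show ?case using assms(1) by simp
next
  case (Suc k)
  have "X \<inter> (\<Inter>i<Suc k. Y i) = (X \<inter> (\<Inter>i<k. Y i)) \<inter> Y k"
    by (auto simp: less_Suc_eq)
  then show ?case using Suc definable_set_Int by (metis less_Suc_eq)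
qed

lemma definable_set_coordinates_eq:
  assumes "i < n" "j < n"
  shows "definable_set L M A n {xs \<in> tuples (univ M) n. xs ! i = xs ! j}"
  by (rule definable_setI[of "[]" _ "Eql (Var i) (Var j)"])
    (use assms in \<open>auto simp: Fm_def sat_def tuples_def\<close>)

lemma definable_set_reindex:
  assumes X: "definable_set L M A n X" and f: "\<And>i. i < n \<Longrightarrow> f i < m"
  shows "definable_set L M A m {ys \<in> tuples (univ M) m. map (\<lambda>i. ys ! f i) [0..<n] \<in> X}"
proof -
  obtain p as where p: "set as \<subseteq> A" "p \<in> Fm L (n + length as)"
    "X = {xs \<in> tuples (univ M) n. sat M p (xs @ as)}"
    using X by (rule definable_setE)
  define g where "g = (\<lambda>i. if i < n then f i else m + (i - n))"
  obtain p' where p': "p' \<in> Fm L (m + length as)"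
    "\<And>ys. sat M p' ys \<longleftrightarrow> sat M p (map (\<lambda>i. ys ! g i) [0..<n + length as])"
    by (rule rename_Fm[OF p(2), of g "m + length as"]) (auto simp: g_def trans_less_add1 f)
  show ?thesis
  proof (rule definable_setI[OF p(1) p'(1)])
    fix ys assume ys: "ys \<in> tuples (univ M) m"
    then have len: "length ys = m" by (simp add: tuples_def)
    have "map (\<lambda>i. (ys @ as) ! g i) [0..<n + length as] = map (\<lambda>i. ys ! f i) [0..<n] @ as"
      by (rule nth_equalityI) (use len f in \<open>auto simp: nth_append g_def\<close>)
    moreover have "map (\<lambda>i. ys ! f i) [0..<n] \<in> tuples (univ M) n"
      using ys f by (auto simp: tuples_def)
    ultimately show "sat M p' (ys @ as) \<longleftrightarrow>
        ys \<in> {ys \<in> tuples (univ M) m. map (\<lambda>i. ys ! f i) [0..<n] \<in> X}"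
      using p'(2)[of "ys @ as"] p(3) ys by simp
  qed auto
qed

lemma definable_set_projection1:
  assumes X: "definable_set L M A (Suc m) X"
  shows "definable_set L M A m {xs \<in> tuples (univ M) m. \<exists>a\<in>univ M. xs @ [a] \<in> X}"
proof -
  obtain p as where p: "set as \<subseteq> A" "p \<in> Fm L (Suc m + length as)"
    "X = {xs \<in> tuples (univ M) (Suc m). sat M p (xs @ as)}"
    using X by (rule definable_setE)
  let ?l = "length as"
  \<comment> \<open>The quantified variable changes places with the parameters, so that these stand last.\<close>
  define f where "f = (\<lambda>i. if i < m then i else if i = m then m + ?l else i - 1)"
  obtain p' where p': "p' \<in> Fm L (Suc (m + ?l))"
    "\<And>ys. sat M p' ys \<longleftrightarrow> sat M p (map (\<lambda>i. ys ! f i) [0..<Suc m + ?l])"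
    by (rule rename_Fm[OF p(2), of f "Suc (m + ?l)"]) (auto simp: f_def)
  show ?thesis
  proof (rule definable_setI[OF p(1), of "Exi (m + ?l) p'"])
    show "Exi (m + ?l) p' \<in> Fm L (m + ?l)"
      using p'(1) by (auto simp: Fm_def less_Suc_eq)
    fix xs assume xs: "xs \<in> tuples (univ M) m"
    then have len: "length xs = m" by (simp add: tuples_def)
    have "eval_fm M ((nth (xs @ as))(m + ?l := a)) p' \<longleftrightarrow> xs @ [a] \<in> X" if a: "a \<in> univ M" for a
    proof -
      have "eval_fm M ((nth (xs @ as))(m + ?l := a)) p' \<longleftrightarrow> sat M p' (xs @ as @ [a])"
        unfolding sat_def
        by (rule eval_fm_cong) (use p'(1) len in \<open>fastforce simp: Fm_def nth_append less_Suc_eq\<close>)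
      also have "map (\<lambda>i. (xs @ as @ [a]) ! f i) [0..<Suc m + ?l] = (xs @ [a]) @ as"
      proof (rule nth_equalityI)
        fix i assume "i < length (map (\<lambda>i. (xs @ as @ [a]) ! f i) [0..<Suc m + ?l])"
        then have i: "i < Suc m + ?l" by simp
        then have "map (\<lambda>i. (xs @ as @ [a]) ! f i) [0..<Suc m + ?l] ! i = (xs @ as @ [a]) ! f i"
          by (simp del: upt_Suc)
        also have "\<dots> = ((xs @ [a]) @ as) ! i"
        proof (cases i m rule: linorder_cases)
          case less
          then show ?thesis using len by (simp add: f_def nth_append)
        next
          case equal
          then show ?thesis using len by (simp add: f_def nth_append)
        next
          case greater
          then obtain j where "i = Suc (m + j)" using less_imp_Suc_add by blast
          then show ?thesis using len i by (simp add: f_def nth_append)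
        qed
        finally show "map (\<lambda>i. (xs @ as @ [a]) ! f i) [0..<Suc m + ?l] ! i = ((xs @ [a]) @ as) ! i" .
      qed (use len in simp)
      then have "sat M p' (xs @ as @ [a]) \<longleftrightarrow> sat M p ((xs @ [a]) @ as)"
        using p'(2)[of "xs @ as @ [a]"] by simp
      also have "\<dots> \<longleftrightarrow> xs @ [a] \<in> X"
        using p(3) xs a by (auto simp: tuples_def)
      finally show ?thesis .
    qed
    then show "sat M (Exi (m + ?l) p') (xs @ as) \<longleftrightarrow>
        xs \<in> {xs \<in> tuples (univ M) m. \<exists>a\<in>univ M. xs @ [a] \<in> X}"
      using xs by (simp add: sat_def)
  qed auto
qed

lemma definable_set_projection:
  assumes "definable_set L M A (m + n) X"
  shows "definable_set L M A m {xs \<in> tuples (univ M) m. \<exists>c\<in>tuples (univ M) n. xs @ c \<in> X}"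
  using assms
proof (induction n arbitrary: X)
  case 0
  then have "{xs \<in> tuples (univ M) m. \<exists>c\<in>tuples (univ M) 0. xs @ c \<in> X} = X"
    using definable_set_subset[OF 0] by (auto simp: tuples_def)
  then show ?case using 0 by simp
next
  case (Suc n)
  let ?X' = "{xs \<in> tuples (univ M) (m + n). \<exists>a\<in>univ M. xs @ [a] \<in> X}"
  have "(\<exists>c\<in>tuples (univ M) (Suc n). xs @ c \<in> X) \<longleftrightarrow> (\<exists>c\<in>tuples (univ M) n. xs @ c \<in> ?X')"
    (is "?l \<longleftrightarrow> ?r") if xs: "xs \<in> tuples (univ M) m" for xs
  proof
    assume ?l
    then obtain c where c: "c \<in> tuples (univ M) (Suc n)" "xs @ c \<in> X" by blast
    then obtain c' a where "c = c' @ [a]"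
      by (cases c rule: rev_cases) (auto simp: tuples_def)
    then show ?r using c xs by (intro bexI[of _ c']) (auto simp: tuples_def)
  next
    assume ?r
    then obtain c a where "c \<in> tuples (univ M) n" "a \<in> univ M" "(xs @ c) @ [a] \<in> X" by blast
    then show ?l by (intro bexI[of _ "c @ [a]"]) (auto simp: tuples_def)
  qed
  then have "{xs \<in> tuples (univ M) m. \<exists>c\<in>tuples (univ M) (Suc n). xs @ c \<in> X} =
      {xs \<in> tuples (univ M) m. \<exists>c\<in>tuples (univ M) n. xs @ c \<in> ?X'}"
    by (intro Collect_cong conj_cong) (rule refl)
  moreover have "definable_set L M A (m + n) ?X'"
    using Suc.prems by (intro definable_set_projection1) simp
  ultimately show ?case by (simp only: Suc.IH)
qed

section \<open>Definable functions from one-point fibres\<close>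

text \<open>
  The function picks the point of each one-point fibre of \<open>X\<close>.  Its graph consists of those points
  \<open>x @ c\<close> of \<open>X\<close> for which no \<open>c'\<close> in the same fibre differs from \<open>c\<close> in any of the \<open>n\<close> coordinates.
  This is a first-order condition, and the domain is the projection of the graph.
\<close>

lemma definable_function_of_unique_fibres:
  assumes X: "definable_set L M A (m + n) X"
  obtains D h where "definable_function L M A m D n h"
    and "\<And>x c. x \<in> tuples (univ M) m \<Longrightarrow> x @ c \<in> X \<Longrightarrow> (\<And>c'. x @ c' \<in> X \<Longrightarrow> c' = c)
      \<Longrightarrow> x \<in> D \<and> h x = c"
proof -
  let ?U = "univ M"
  have XU: "X \<subseteq> tuples ?U (m + n)" by (rule definable_set_subset[OF X])
  define f where "f = (\<lambda>i. if i < m then i else i + n)"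
  \<comment> \<open>The triples \<open>x @ c @ c'\<close> with \<open>x @ c' \<in> X\<close> such that \<open>c\<close> and \<open>c'\<close> differ in coordinate \<open>i\<close>.\<close>
  define R where "R = (\<lambda>i.
    {z \<in> tuples ?U (m + n + n). map (\<lambda>i. z ! f i) [0..<m + n] \<in> X} \<inter>
    (tuples ?U (m + n + n) - {z \<in> tuples ?U (m + n + n). z ! (m + i) = z ! (m + n + i)}))"
  have R: "definable_set L M A (m + n + n) (R i)" if "i < n" for i
    unfolding R_def
    by (intro definable_set_Int definable_set_compl definable_set_reindex[OF X]
        definable_set_coordinates_eq) (use that in \<open>auto simp: f_def\<close>)
  have in_R: "x @ c @ c' \<in> R i \<longleftrightarrow> x @ c' \<in> X \<and> c ! i \<noteq> c' ! i"
    if "x \<in> tuples ?U m" "c \<in> tuples ?U n" "c' \<in> tuples ?U n" "i < n" for x c c' i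
  proof -
    have "map (\<lambda>i. (x @ c @ c') ! f i) [0..<m + n] = x @ c'"
      by (rule nth_equalityI) (use that in \<open>auto simp: tuples_def nth_append f_def\<close>)
    then show ?thesis using that by (auto simp: R_def tuples_def nth_append)
  qed
  define \<Gamma> where "\<Gamma> = X \<inter> (\<Inter>i<n. tuples ?U (m + n) -
    {z \<in> tuples ?U (m + n). \<exists>c'\<in>tuples ?U n. z @ c' \<in> R i})"
  have \<Gamma>: "definable_set L M A (m + n) \<Gamma>"
    unfolding \<Gamma>_def
    by (intro definable_set_Int_INT X definable_set_compl definable_set_projection R)
  have mem_\<Gamma>: "z \<in> \<Gamma> \<longleftrightarrow> z \<in> X \<and> (\<forall>i<n. \<forall>c'\<in>tuples ?U n. z @ c' \<notin> R i)" for z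
    unfolding \<Gamma>_def using XU by blast
  have fibre: "c' \<in> tuples ?U n" if "x \<in> tuples ?U m" "x @ c' \<in> X" for x c'
  proof -
    have "x @ c' \<in> tuples ?U (m + n)" using that(2) XU by blast
    then show ?thesis using that(1) by (auto simp: tuples_def)
  qed
  have in_\<Gamma>: "x @ c \<in> \<Gamma> \<longleftrightarrow> x @ c \<in> X \<and> (\<forall>c'. x @ c' \<in> X \<longrightarrow> c' = c)" (is "?l \<longleftrightarrow> ?r")
    if x: "x \<in> tuples ?U m" for x c
  proof
    assume l: ?l
    then have c: "x @ c \<in> X" by (simp add: mem_\<Gamma>)
    have "c' = c" if c': "x @ c' \<in> X" for c'
    proof (rule nth_equalityI)
      show "length c' = length c"
        using fibre[OF x c] fibre[OF x c'] by (simp add: tuples_def)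
      fix i assume "i < length c'"
      then have i: "i < n" using fibre[OF x c'] by (simp add: tuples_def)
      then have "x @ c @ c' \<notin> R i"
        using l fibre[OF x c'] by (simp add: mem_\<Gamma>)
      then show "c' ! i = c ! i"
        using in_R[OF x fibre[OF x c] fibre[OF x c'] i] c' by simp
    qed
    then show ?r using c by blast
  next
    assume r: ?r
    then have c: "c \<in> tuples ?U n" using fibre[OF x] by blast
    have "x @ c @ c' \<notin> R i" if "i < n" "c' \<in> tuples ?U n" for i c'
      using in_R[OF x c that(2,1)] r by auto
    then show ?l using r by (simp add: mem_\<Gamma>)
  qed
  define D where "D = {x \<in> tuples ?U m. \<exists>c\<in>tuples ?U n. x @ c \<in> \<Gamma>}"
  define h where "h = (\<lambda>x. THE c. x @ c \<in> \<Gamma>)"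
  have h: "h x = c" if "x \<in> tuples ?U m" "x @ c \<in> \<Gamma>" for x c
    unfolding h_def by (rule the_equality) (use that in \<open>auto simp: in_\<Gamma>\<close>)
  have hD: "x @ h x \<in> \<Gamma> \<and> h x \<in> tuples ?U n \<and> x \<in> tuples ?U m" if "x \<in> D" for x
    using that h by (auto simp: D_def)
  have "z \<in> {x @ h x | x. x \<in> D}" if "z \<in> \<Gamma>" for z
  proof -
    have "z \<in> tuples ?U (m + n)" using that XU by (auto simp: mem_\<Gamma>)
    then have "take m z \<in> tuples ?U m" "drop m z \<in> tuples ?U n"
      by (auto simp: tuples_def dest: in_set_takeD in_set_dropD)
    moreover have "take m z @ drop m z \<in> \<Gamma>" using that by simp
    ultimately have "take m z \<in> D \<and> h (take m z) = drop m z"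
      using h unfolding D_def by blast
    then show ?thesis by (metis (mono_tags, lifting) append_take_drop_id mem_Collect_eq)
  qed
  then have graph: "{x @ h x | x. x \<in> D} = \<Gamma>" using hD by blast
  show ?thesis
  proof (rule that[of D h])
    have "definable_set L M A m D"
      unfolding D_def by (rule definable_set_projection[OF \<Gamma>])
    moreover have "h \<in> D \<rightarrow> tuples ?U n" using hD by blast
    ultimately show "definable_function L M A m D n h"
      unfolding definable_function_def graph using \<Gamma> by blast
    fix x c assume x: "x \<in> tuples ?U m" and c: "x @ c \<in> X" "\<And>c'. x @ c' \<in> X \<Longrightarrow> c' = c"
    have "x @ c \<in> \<Gamma>" unfolding in_\<Gamma>[OF x] using c by blast
    moreover from this have "x \<in> D" using x fibre[OF x c(1)] unfolding D_def by blast
    ultimately show "x \<in> D \<and> h x = c" using h[OF x] by blast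
  qed
qed

section \<open>Maps on the automorphism group\<close>

theorem lemma3p13:
  fixes L :: "('f, 'r) lang"
    and T :: "('f, 'r) fm set"
    and M :: "('m, 'f, 'r) struct"
    and A B :: "'m set"
    and n :: nat
    and G :: "'m list monoid"
    and \<phi> :: "('m \<Rightarrow> 'm) \<Rightarrow> 'm list"
  assumes "complete_theory L T"
    and "eliminates_imaginaries L T"
    and "models L M T"
    and "A \<subseteq> univ M"
    and "atomic_over L M A"
    and "strongly_omega_homogeneous_over L M A"
    and "normal_extension L M A B"
    and "B = dcl L M B"
    and "\<forall>\<sigma>\<in>Aut_over L M B A. \<exists>\<tau>\<in>automorphisms L M. \<forall>b\<in>B. \<tau> b = \<sigma> b"
    and "atomic_over L M B"
    and "strongly_omega_homogeneous_over L M B"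
    and "definable_group L M A n G"
    and "\<phi> \<in> Aut_over L M B A \<rightarrow> group_points G B"
  shows "(\<exists>k D h. \<exists>b\<in>tuples B k.
            definable_function L M A (k + k) D n h \<and>
            (\<forall>\<sigma>\<in>Aut_over L M B A. b @ map \<sigma> b \<in> D \<and> \<phi> \<sigma> = h (b @ map \<sigma> b)))
     \<longleftrightarrow> definable_in_Aut_times L M A B n (carrier G) {(\<sigma>, \<phi> \<sigma>) | \<sigma>. \<sigma> \<in> Aut_over L M B A}"
proof
  let ?U = "univ M"
  let ?Aut = "Aut_over L M B A"
  let ?gr = "{(\<sigma>, \<phi> \<sigma>) | \<sigma>. \<sigma> \<in> ?Aut}"
  have BU: "B \<subseteq> ?U" using assms(7) by (simp add: normal_extension_def)
  have carrier: "definable_set L M A n (carrier G)"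
    using assms(12) by (simp add: definable_group_def)
  have \<phi>: "\<phi> \<sigma> \<in> carrier G" if "\<sigma> \<in> ?Aut" for \<sigma>
    using assms(13) that by (auto simp: group_points_def)
  have pair: "b @ map \<sigma> b \<in> tuples ?U (k + k)" if "\<sigma> \<in> ?Aut" "b \<in> tuples B k" for \<sigma> b k
  proof -
    have "\<sigma> permutes B" using that(1) by (simp add: Aut_over_def)
    then have "\<sigma> x \<in> B" if "x \<in> B" for x using that by (simp add: permutes_in_image)
    then show ?thesis using that(2) BU by (auto simp: tuples_def)
  qed
  {
    assume "\<exists>k D h. \<exists>b\<in>tuples B k. definable_function L M A (k + k) D n h \<and>
      (\<forall>\<sigma>\<in>?Aut. b @ map \<sigma> b \<in> D \<and> \<phi> \<sigma> = h (b @ map \<sigma> b))"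
    then obtain k D h b where b: "b \<in> tuples B k" and h: "definable_function L M A (k + k) D n h"
      and \<phi>h: "\<And>\<sigma>. \<sigma> \<in> ?Aut \<Longrightarrow> b @ map \<sigma> b \<in> D \<and> \<phi> \<sigma> = h (b @ map \<sigma> b)"
      by blast
    obtain q where q: "q \<in> PFm L A (k + k + n)"
      and graph: "{x @ h x | x. x \<in> D} = {xs \<in> tuples ?U (k + k + n). psat M q xs}"
      using h unfolding definable_function_def definable_set_def by blast
    have DU: "D \<subseteq> tuples ?U (k + k)"
      using h definable_set_subset[of L M A "k + k" D] by (simp add: definable_function_def)
    have "psat M q (b @ map \<sigma> b @ c) \<longleftrightarrow> c = \<phi> \<sigma>" if \<sigma>: "\<sigma> \<in> ?Aut" and c: "c \<in> carrier G" for \<sigma> c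
    proof -
      have "c \<in> tuples ?U n" using c definable_set_subset[OF carrier] by blast
      then have "(b @ map \<sigma> b) @ c \<in> tuples ?U (k + k + n)"
        using pair[OF \<sigma> b] by (auto simp: tuples_def)
      then have "psat M q (b @ map \<sigma> b @ c) \<longleftrightarrow> (b @ map \<sigma> b) @ c \<in> {x @ h x | x. x \<in> D}"
        unfolding graph by simp
      also have "\<dots> \<longleftrightarrow> c = h (b @ map \<sigma> b)"
      proof
        assume "(b @ map \<sigma> b) @ c \<in> {x @ h x | x. x \<in> D}"
        then obtain x where x: "x \<in> D" and eq: "(b @ map \<sigma> b) @ c = x @ h x" by blast
        have "length (b @ map \<sigma> b) = length x"
          using x DU pair[OF \<sigma> b] by (auto simp: tuples_def)
        then have "b @ map \<sigma> b = x \<and> c = h x"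
          using eq append_eq_append_conv[of "b @ map \<sigma> b" x c "h x"] by blast
        then show "c = h (b @ map \<sigma> b)" by blast
      next
        assume "c = h (b @ map \<sigma> b)"
        then show "(b @ map \<sigma> b) @ c \<in> {x @ h x | x. x \<in> D}" using \<phi>h[OF \<sigma>] by blast
      qed
      finally show ?thesis using \<phi>h[OF \<sigma>] by simp
    qed
    then have "?gr = {(\<sigma>, c). \<sigma> \<in> ?Aut \<and> c \<in> carrier G \<and> psat M q (b @ map \<sigma> b @ c)}"
      using \<phi> by auto
    then show "definable_in_Aut_times L M A B n (carrier G) ?gr"
      using q b unfolding definable_in_Aut_times_def by blast
  }
  {
    assume "definable_in_Aut_times L M A B n (carrier G) ?gr"
    then obtain k q b where q: "q \<in> PFm L A (k + k + n)" and b: "b \<in> tuples B k"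
      and gr: "?gr = {(\<sigma>, c). \<sigma> \<in> ?Aut \<and> c \<in> carrier G \<and> psat M q (b @ map \<sigma> b @ c)}"
      unfolding definable_in_Aut_times_def by blast
    have val: "c \<in> carrier G \<and> psat M q (b @ map \<sigma> b @ c) \<longleftrightarrow> c = \<phi> \<sigma>" if "\<sigma> \<in> ?Aut" for \<sigma> c
    proof -
      have "(\<sigma>, c) \<in> ?gr \<longleftrightarrow> c \<in> carrier G \<and> psat M q (b @ map \<sigma> b @ c)"
        unfolding gr using that by simp
      then show ?thesis using that by auto
    qed
    \<comment> \<open>Restricting the fibres to \<open>G(M)\<close> is essential: the formula alone need not determine \<open>\<phi> \<sigma>\<close>.\<close>
    define X where "X = {z \<in> tuples ?U (k + k + n). psat M q z} \<inter>
      {z \<in> tuples ?U (k + k + n). map (\<lambda>i. z ! (k + k + i)) [0..<n] \<in> carrier G}"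
    have "definable_set L M A (k + k + n) {z \<in> tuples ?U (k + k + n). psat M q z}"
      using q by (auto simp: definable_set_def)
    then have "definable_set L M A (k + k + n) X"
      unfolding X_def by (intro definable_set_Int definable_set_reindex[OF carrier]) auto
    then obtain D h where h: "definable_function L M A (k + k) D n h"
      and fib: "\<And>x c. x \<in> tuples ?U (k + k) \<Longrightarrow> x @ c \<in> X \<Longrightarrow> (\<And>c'. x @ c' \<in> X \<Longrightarrow> c' = c)
        \<Longrightarrow> x \<in> D \<and> h x = c"
      by (rule definable_function_of_unique_fibres) blast
    have "b @ map \<sigma> b \<in> D \<and> \<phi> \<sigma> = h (b @ map \<sigma> b)" if \<sigma>: "\<sigma> \<in> ?Aut" for \<sigma>
    proof -
      let ?x = "b @ map \<sigma> b"
      have x: "?x \<in> tuples ?U (k + k)" by (rule pair[OF \<sigma> b])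
      have X_iff: "?x @ c \<in> X \<longleftrightarrow> c = \<phi> \<sigma>" for c
      proof (cases "c \<in> tuples ?U n")
        case True
        then have "?x @ c \<in> tuples ?U (k + k + n)" using x by (auto simp: tuples_def)
        moreover have "map (\<lambda>i. (?x @ c) ! (k + k + i)) [0..<n] = c"
        proof (rule nth_equalityI)
          fix i assume "i < length (map (\<lambda>i. (?x @ c) ! (k + k + i)) [0..<n])"
          moreover have "(?x @ c) ! (k + k + i) = c ! i"
            using x nth_append_length_plus[of ?x c i] by (simp add: tuples_def)
          ultimately show "map (\<lambda>i. (?x @ c) ! (k + k + i)) [0..<n] ! i = c ! i" by simp
        qed (use True in \<open>simp add: tuples_def\<close>)
        ultimately show ?thesis using val[OF \<sigma>, of c] by (auto simp: X_def)
      next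
        case False
        then have "c \<noteq> \<phi> \<sigma>" using \<phi>[OF \<sigma>] definable_set_subset[OF carrier] by blast
        moreover have "?x @ c \<notin> X" using False x by (auto simp: X_def tuples_def)
        ultimately show ?thesis by blast
      qed
      have "?x \<in> D \<and> h ?x = \<phi> \<sigma>" by (rule fib[OF x]) (use X_iff in blast)+
      then show ?thesis by simp
    qed
    then show "\<exists>k D h. \<exists>b\<in>tuples B k. definable_function L M A (k + k) D n h \<and>
        (\<forall>\<sigma>\<in>?Aut. b @ map \<sigma> b \<in> D \<and> \<phi> \<sigma> = h (b @ map \<sigma> b))"
      using h b by blast
  }
qed

end
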